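(* Let $g\in\mathbb{C}^N$ and let $V(g)=\operatorname{span}\{T_i g : 1\le i\le N\}$. Then $V(g)$ is a shift invariant space.
   Context: Let $G$ be an undirected, connected, weighted graph with vertex set $\mathcal V=\{1,\dots,N\}$, and let $A$ be an $N\times N$ diagonalizable matrix associated with $G$ (for example its adjacency matrix or its graph Laplacian), with eigenvalues $\lambda_1,\dots,\lambda_N$ (listed with multiplicity) and corresponding eigenvectors $\chi_1,\dots,\chi_N$ forming an orthonormal basis of $\mathbb{C}^N$. A signal $f:\mathcal V\to\mathbb{C}$ is identified with the vector $(f(1),\dots,f(N))\in\mathbb{C}^N$. The graph Fourier transform of $f\in\mathbb{C}^N$ is $\widehat f(\lambda_l)=\sum_{n=1}^N f(n)\overline{\chi_l(n)}$, $l=1,\dots,N$ (indexed by $l$). The generalized convolution is $(f\ast g)(n)=\sum_{l=1}^N \widehat f(\lambda_l)\widehat g(\lambda_l)\chi_l(n)$. For $i=1,\dots,N$, $\delta_i\in\mathbb{C}^N$ is given by $\delta_i(n)=1$ if $n=i$ and $0$ otherwise, and the generalized translation is $T_i f=\sqrt N\,(f\ast\delta_i)$. A subspace $V$ of $\mathbb{C}^N$ is called a shift invariant space if $f\in V$ implies $T_i f\in V$ for all $i\in\{1,\dots,N\}$. *)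

theory Defs
  imports "HOL-Analysis.Analysis"
begin

text \<open>
  The vertex set is a finite type \<open>'n\<close>, so \<open>N = CARD('n)\<close> and a signal is a vector of type
  \<open>complex^'n\<close>. The spectral index \<open>l\<close> ranges over the same type. Subspace, span and
  independence are the complex ones (\<open>vec.subspace\<close>, \<open>vec.span\<close>, \<open>vec.independent\<close>); the
  unqualified constants are real-linear.
\<close>

text \<open>
  A weighted graph is given by its real weight matrix: \<open>i\<close> and \<open>j\<close> are joined iff
  \<open>W $ i $ j \<noteq> 0\<close>. Loops and negative weights are not excluded.
\<close>

definition undirected_graph :: "real^'n^'n \<Rightarrow> bool" where
  "undirected_graph W \<longleftrightarrow> (\<forall>i j. W $ i $ j = W $ j $ i)"

definition connected_graph :: "real^'n^'n \<Rightarrow> bool" where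
  "connected_graph W \<longleftrightarrow> (\<forall>i j. (i, j) \<in> {(a, b). W $ a $ b \<noteq> 0}\<^sup>*)"

definition diagonal_matrix :: "complex^'n^'n \<Rightarrow> bool" where
  "diagonal_matrix D \<longleftrightarrow> (\<forall>i j. i \<noteq> j \<longrightarrow> D $ i $ j = 0)"

definition diagonalizable_matrix :: "complex^'n^'n \<Rightarrow> bool" where
  "diagonalizable_matrix A \<longleftrightarrow>
    (\<exists>(P::complex^'n^'n) D. invertible P \<and> diagonal_matrix D \<and> A = P ** D ** matrix_inv P)"

text \<open>The class operation \<open>\<bullet>\<close> on \<open>complex^'n\<close> is real-valued, hence a separate definition.\<close>

definition hermitian_inner :: "complex^'n \<Rightarrow> complex^'n \<Rightarrow> complex" where
  "hermitian_inner u v = (\<Sum>n\<in>UNIV. u $ n * cnj (v $ n))"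

definition orthonormal_basis :: "('n \<Rightarrow> complex^'n) \<Rightarrow> bool" where
  "orthonormal_basis chi \<longleftrightarrow>
    (\<forall>k l. hermitian_inner (chi k) (chi l) = (if k = l then 1 else 0)) \<and>
    vec.independent (range chi) \<and> vec.span (range chi) = UNIV"

text \<open>
  The coefficient customarily written as a function of the eigenvalue is indexed by \<open>l\<close>
  itself, so repeated eigenvalues cause no clash.
\<close>

definition graph_fourier :: "('n \<Rightarrow> complex^'n) \<Rightarrow> complex^'n \<Rightarrow> complex^'n" where
  "graph_fourier chi f = (\<chi> l. \<Sum>n\<in>UNIV. f $ n * cnj (chi l $ n))"

definition graph_convolution ::
    "('n \<Rightarrow> complex^'n) \<Rightarrow> complex^'n \<Rightarrow> complex^'n \<Rightarrow> complex^'n" where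
  "graph_convolution chi f g =
    (\<chi> n. \<Sum>l\<in>UNIV. graph_fourier chi f $ l * graph_fourier chi g $ l * chi l $ n)"

text \<open>The signal \<open>\<delta>\<^sub>i\<close> is \<open>axis i 1\<close>.\<close>

definition graph_translation ::
    "('n \<Rightarrow> complex^'n) \<Rightarrow> 'n \<Rightarrow> complex^'n \<Rightarrow> complex^'n" where
  "graph_translation chi i f =
    complex_of_real (sqrt (real CARD('n))) *s graph_convolution chi f (axis i 1)"

definition shift_invariant_space ::
    "('n \<Rightarrow> complex^'n) \<Rightarrow> (complex^'n) set \<Rightarrow> bool" where
  "shift_invariant_space chi V \<longleftrightarrow>
    vec.subspace V \<and> (\<forall>f\<in>V. \<forall>i. graph_translation chi i f \<in> V)"

definition generated_space :: "('n \<Rightarrow> complex^'n) \<Rightarrow> complex^'n \<Rightarrow> (complex^'n) set" where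
  "generated_space chi g = vec.span (range (\<lambda>i. graph_translation chi i g))"

end

theory Submission
  imports Defs
begin

text \<open>
  Convolution is linear in each argument and, by orthonormality, becomes multiplication under the
  Fourier transform, hence is associative. Expanding \<open>h\<close> in the delta basis writes every
  \<open>g \<ast> h\<close> as a combination of the translates of \<open>g\<close>. Therefore
  \<open>T\<^sub>i (T\<^sub>k g) = N (g \<ast> (\<delta>\<^sub>k \<ast> \<delta>\<^sub>i))\<close> lies in \<open>V(g)\<close>.
\<close>

lemma graph_fourier_eq_hermitian_inner: "graph_fourier chi f $ l = hermitian_inner f (chi l)"
  by (simp add: graph_fourier_def hermitian_inner_def)

text \<open>Swap the sums over \<open>I\<close> and over the coordinates. For infinite
  \<open>I\<close> both sides are 0 by convention.\<close>

lemma hermitian_inner_sum_scale_left: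
  "hermitian_inner (\<Sum>i\<in>I. c i *s v i) w = (\<Sum>i\<in>I. c i * hermitian_inner (v i) w)"
  unfolding hermitian_inner_def sum_component vector_smult_component sum_distrib_right sum_distrib_left
  by (subst sum.swap) (simp add: mult.assoc)

text \<open>The vector form of the pointwise definition, from which orthonormality can read off
  coefficients.\<close>

lemma graph_convolution_eq_sum:
  "graph_convolution chi f g =
    (\<Sum>l\<in>UNIV. (graph_fourier chi f $ l * graph_fourier chi g $ l) *s chi l)"
  by (simp add: graph_convolution_def vec_eq_iff)

text \<open>Pairing the expansion with \<open>chi l\<close> kills every term but the
  \<open>l\<close>-th.\<close>

lemma graph_fourier_convolution:
  assumes "orthonormal_basis chi"
  shows "graph_fourier chi (graph_convolution chi f g) $ l =
    graph_fourier chi f $ l * graph_fourier chi g $ l"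
  using assms
  by (simp add: orthonormal_basis_def graph_fourier_eq_hermitian_inner graph_convolution_eq_sum
      hermitian_inner_sum_scale_left if_distrib[of "(*) _"] cong: if_cong)

lemma graph_convolution_assoc:
  assumes "orthonormal_basis chi"
  shows "graph_convolution chi (graph_convolution chi f g) h =
    graph_convolution chi f (graph_convolution chi g h)"
  \<comment> \<open>Only the outer convolutions are expanded; the transforms of the inner ones then
    turn into products, and both sides get the same coefficients in \<open>chi\<close>.\<close>
  unfolding graph_convolution_eq_sum[of chi "graph_convolution chi f g"]
    graph_convolution_eq_sum[of chi f "graph_convolution chi g h"]
  by (simp add: graph_fourier_convolution[OF assms] mult.assoc)

lemma graph_convolution_commute: "graph_convolution chi f g = graph_convolution chi g f"
  by (simp add: graph_convolution_def mult.commute)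

lemma graph_convolution_sum_scale_right:
  "graph_convolution chi f (\<Sum>i\<in>I. c i *s v i) = (\<Sum>i\<in>I. c i *s graph_convolution chi f (v i))"
  unfolding graph_convolution_eq_sum graph_fourier_eq_hermitian_inner hermitian_inner_sum_scale_left
    vec.scale_sum_right sum_distrib_left vec.scale_sum_left
  by (subst sum.swap) (simp add: mult.left_commute)

lemma graph_convolution_scale_left:
  "graph_convolution chi (c *s f) g = c *s graph_convolution chi f g"
  \<comment> \<open>A one-point index set turns the sum rule into scaling; commutativity carries it
    to the left argument.\<close>
  using graph_convolution_sum_scale_right[of chi g "\<lambda>_. c" "\<lambda>_. f" "{()}"]
  by (simp add: graph_convolution_commute[of chi _ g])

lemma graph_translation_sum_scale:
  "graph_translation chi i (\<Sum>j\<in>I. c j *s v j) = (\<Sum>j\<in>I. c j *s graph_translation chi i (v j))"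
  by (simp add: graph_translation_def graph_convolution_commute[of chi _ "axis i 1"]
      graph_convolution_sum_scale_right vec.scale_sum_right mult.commute)

lemma graph_convolution_in_generated_space: "graph_convolution chi g h \<in> generated_space chi g"
proof -
  let ?s = "complex_of_real (sqrt (real CARD('a)))"
  \<comment> \<open>The vertex type is nonempty, so the normalizing factor of
    \<open>graph_translation\<close> can be divided out.\<close>
  have s: "?s \<noteq> 0" by simp
  have "h = (\<Sum>i\<in>UNIV. h $ i *s axis i 1)"
    by (simp add: basis_expansion)
  then have "graph_convolution chi g h = (\<Sum>i\<in>UNIV. h $ i *s graph_convolution chi g (axis i 1))"
    by (metis graph_convolution_sum_scale_right)
  also have "\<dots> = (\<Sum>i\<in>UNIV. (h $ i / ?s) *s graph_translation chi i g)"
    using s by (simp add: graph_translation_def)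
  also have "\<dots> \<in> generated_space chi g"
    unfolding generated_space_def
    by (intro vec.span_sum vec.span_scale vec.span_base rangeI)
  finally show ?thesis .
qed

text \<open>Associativity moves \<open>g\<close> to the front, which makes
  \<open>graph_convolution_in_generated_space\<close> applicable.\<close>

lemma graph_translation_twice:
  fixes chi :: "'n \<Rightarrow> complex^'n"
  assumes "orthonormal_basis chi"
  shows "graph_translation chi i (graph_translation chi k g) =
    of_nat CARD('n) *s graph_convolution chi g (graph_convolution chi (axis k 1) (axis i 1))"
proof -
  have "complex_of_real (sqrt (real CARD('n))) * complex_of_real (sqrt (real CARD('n))) =
      of_nat CARD('n)"
    by (simp flip: of_real_mult)
  then show ?thesis
    by (simp add: graph_translation_def graph_convolution_scale_left graph_convolution_assoc[OF assms])
qed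

theorem mainTheorem1:
  fixes W :: "real^'n^'n"
    and A :: "complex^'n^'n"
    and lam :: "'n \<Rightarrow> complex"
    and chi :: "'n \<Rightarrow> complex^'n"
    and g :: "complex^'n"
  assumes "undirected_graph W"
    and "connected_graph W"
    and "diagonalizable_matrix A"
    and "\<forall>l. A *v chi l = lam l *s chi l"
    and "orthonormal_basis chi"
  shows "shift_invariant_space chi (generated_space chi g)"
  unfolding shift_invariant_space_def
proof (intro conjI ballI allI)
  show subspace: "vec.subspace (generated_space chi g)"
    by (simp add: generated_space_def)
  fix f i
  assume "f \<in> generated_space chi g"
  then obtain T c where T: "T \<subseteq> range (\<lambda>k. graph_translation chi k g)"
    and f: "f = (\<Sum>v\<in>T. c v *s v)"
    unfolding generated_space_def vec.span_explicit by blast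
  \<comment> \<open>Translation is linear, so only the spanning translates of \<open>g\<close> have
    to be checked.\<close>
  have "graph_translation chi i v \<in> generated_space chi g" if v: "v \<in> T" for v
  proof -
    obtain k where "v = graph_translation chi k g"
      using T v by blast
    then show ?thesis
      using vec.subspace_scale[OF subspace graph_convolution_in_generated_space]
      by (simp add: graph_translation_twice[OF assms(5)])
  qed
  then show "graph_translation chi i f \<in> generated_space chi g"
    unfolding f graph_translation_sum_scale
    by (intro vec.subspace_sum[OF subspace] vec.subspace_scale[OF subspace])
qed

end
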